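(* For every $0<\varepsilon\le 1$ and for each of the types (a), (b), (c) there exists an admissible cutoff function $\hat a$ of that type such that, for every integer $n\ge 1$, the kernel $$L_n(x,y):=\sum_{j=0}^\infty \hat a\Big(\frac{j}{n}\Big)\tilde T_j(x)\tilde T_j(y)$$ satisfies $$|L_n(x,y)|\le c\,n\exp\left\{-\frac{c'\varepsilon\, n\rho(x,y)}{[\ln(e+n\rho(x,y))]^{1+\varepsilon}}\right\},\qquad x,y\in[-1,1],$$ where $c'>0$ is an absolute constant and $c$ depends only on $\varepsilon$.
   Context: The normalized Chebyshev polynomials are $\tilde T_n(x):=\sqrt{2/\pi}\cos(n\arccos x)$ for $n\ge1$ and $\tilde T_0:=\sqrt{1/\pi}$; they form an orthonormal basis of $L^2([-1,1],(1-x^2)^{-1/2}dx)$. The distance on $[-1,1]$ is $\rho(x,y):=|\arccos x-\arccos y|$. A function $\hat a\in C^\infty[0,\infty)$ is an admissible cutoff function of type (a) if $\operatorname{supp}\hat a\subset[0,2]$ and $\hat a(t)=1$ for $t\in[0,1]$; of type (b) if $\operatorname{supp}\hat a\subset[1/2,2]$; of type (c) if $\operatorname{supp}\hat a\subset[1/2,2]$ and $|\hat a(t)|^2+|\hat a(t/2)|^2=1$ for $t\in[1,2]$. *)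

theory Defs
  imports "HOL-Analysis.Analysis"
begin

definition cheb :: "nat \<Rightarrow> real \<Rightarrow> real" where
  "cheb n x = (if n = 0 then sqrt (1 / pi) else sqrt (2 / pi) * cos (real n * arccos x))"

definition rho :: "real \<Rightarrow> real \<Rightarrow> real" where
  "rho x y = \<bar>arccos x - arccos y\<bar>"

definition smooth_nonneg :: "(real \<Rightarrow> real) \<Rightarrow> bool" where
  "smooth_nonneg f \<longleftrightarrow> (\<exists>D :: nat \<Rightarrow> real \<Rightarrow> real. D 0 = f \<and>
     (\<forall>k. \<forall>t\<ge>0. (D k has_real_derivative D (Suc k) t) (at t within {0..})))"

text \<open>Admissible cutoff functions of types (a), (b), (c). Support conditions are written
  as vanishing outside the given closed interval (within the domain [0,oo)).\<close>
definition admissible_a :: "(real \<Rightarrow> real) \<Rightarrow> bool" where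
  "admissible_a f \<longleftrightarrow> smooth_nonneg f \<and> (\<forall>t\<ge>0. t \<notin> {0..2} \<longrightarrow> f t = 0)
     \<and> (\<forall>t\<in>{0..1}. f t = 1)"

definition admissible_b :: "(real \<Rightarrow> real) \<Rightarrow> bool" where
  "admissible_b f \<longleftrightarrow> smooth_nonneg f \<and> (\<forall>t\<ge>0. t \<notin> {1/2..2} \<longrightarrow> f t = 0)"

definition admissible_c :: "(real \<Rightarrow> real) \<Rightarrow> bool" where
  "admissible_c f \<longleftrightarrow> smooth_nonneg f \<and> (\<forall>t\<ge>0. t \<notin> {1/2..2} \<longrightarrow> f t = 0)
     \<and> (\<forall>t\<in>{1..2}. \<bar>f t\<bar>^2 + \<bar>f (t/2)\<bar>^2 = 1)"

definition kernel :: "(real \<Rightarrow> real) \<Rightarrow> nat \<Rightarrow> real \<Rightarrow> real \<Rightarrow> real" where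
  "kernel f n x y = (\<Sum>j. f (real j / real n) * cheb j x * cheb j y)"

end

theory Submission
  imports "HOL-Probability.Infinite_Product_Measure" Defs
begin

text \<open>
  With \<open>x = cos \<alpha>\<close> and \<open>y = cos \<beta>\<close> the kernel is a combination of the values at \<open>\<alpha> - \<beta>\<close> and
  \<open>\<alpha> + \<beta>\<close> of the trigonometric sum with coefficients \<open>f (\<bar>j\<bar> / n)\<close>.  Summing \<open>k\<close> times by
  parts bounds such a sum at \<open>t\<close> by a multiple of \<open>n (n \<bar>t\<bar> / 2) ^ (- k)\<close> times the supremum
  of the \<open>k\<close>-th derivative of the even extension of \<open>f\<close>.

  A cutoff whose \<open>k\<close>-th derivative is at most \<open>(C / \<epsilon>) ^ k k!\<close> times the product of
  \<open>ln (e + j) powr (1 + \<epsilon>)\<close> over \<open>j = 1, \<dots>, k\<close> is the expectation of a trapezoid shifted by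
  \<open>\<Sum>j. \<delta> j * U j\<close>, where the \<open>U j\<close> are independent and uniform on \<open>{-1/2..1/2}\<close>: averaging over one
  \<open>U j\<close> turns a derivative into a difference quotient, at the price of a factor \<open>2 / \<delta> j\<close>.  The
  widths \<open>\<delta> j\<close> are half the differences of \<open>ln (e + j) powr - \<epsilon>\<close>; they add up to \<open>1 / 2\<close> whatever
  \<open>\<epsilon>\<close> is.  This bump \<open>b\<close> is of type (a), and \<open>sin (\<pi> / 2 (b t - b (2 t)))\<close> is of types (b) and
  (c); composition with the sine preserves the derivative bounds up to a factor \<open>C ^ k\<close> because the
  weights are supermultiplicative with respect to binomial convolution.
  Taking \<open>k\<close> to be about \<open>c \<epsilon> n \<rho> / ln (e + n \<rho>) powr (1 + \<epsilon>)\<close> gives the theorem.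
\<close>

subsection \<open>Sequences of successive derivatives\<close>

definition deriv_seq :: "(nat \<Rightarrow> real \<Rightarrow> 'a::real_normed_vector) \<Rightarrow> bool" where
  "deriv_seq D \<longleftrightarrow> (\<forall>k t. (D k has_vector_derivative D (Suc k) t) (at t))"

lemma deriv_seqD: "deriv_seq D \<Longrightarrow> (D k has_vector_derivative D (Suc k) t) (at t)"
  by (simp add: deriv_seq_def)

lemma deriv_seq_add:
  "deriv_seq D \<Longrightarrow> deriv_seq E \<Longrightarrow> deriv_seq (\<lambda>k t. D k t + E k t)"
  by (simp add: deriv_seq_def has_vector_derivative_add)

lemma deriv_seq_diff:
  "deriv_seq D \<Longrightarrow> deriv_seq E \<Longrightarrow> deriv_seq (\<lambda>k t. D k t - E k t)"
  by (simp add: deriv_seq_def has_vector_derivative_diff)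

lemma deriv_seq_bounded_linear:
  "bounded_linear h \<Longrightarrow> deriv_seq D \<Longrightarrow> deriv_seq (\<lambda>k t. h (D k t))"
  by (simp add: deriv_seq_def bounded_linear.has_vector_derivative)

lemma deriv_seq_affine:
  assumes "deriv_seq D"
  shows "deriv_seq (\<lambda>k t. a ^ k *\<^sub>R D k (a * t + b))"
  unfolding deriv_seq_def
proof (intro allI)
  fix k t
  have "((\<lambda>t. D k (a * t + b)) has_vector_derivative a *\<^sub>R D (Suc k) (a * t + b)) (at t)"
    using assms unfolding deriv_seq_def
    by (intro vector_diff_chain_at[unfolded o_def, where f = "\<lambda>t. a * t + b"])
       (auto intro!: derivative_eq_intros)
  from has_vector_derivative_scaleR[OF DERIV_const this, of "a ^ k"]
  show "((\<lambda>t. a ^ k *\<^sub>R D k (a * t + b)) has_vector_derivative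
      a ^ Suc k *\<^sub>R D (Suc k) (a * t + b)) (at t)"
    by (simp add: mult.commute)
qed

lemma deriv_seq_even_part:
  assumes "deriv_seq D"
  shows "deriv_seq (\<lambda>k t. (D k t + (- 1) ^ k *\<^sub>R D k (- t)) /\<^sub>R 2)"
  using deriv_seq_affine[OF assms, of "- 1" 0]
  by (intro deriv_seq_bounded_linear[OF bounded_linear_scaleR_right] deriv_seq_add assms) simp

lemma deriv_seq_imp_smooth_nonneg:
  assumes "deriv_seq D"
  shows "smooth_nonneg (D 0)"
  unfolding smooth_nonneg_def using deriv_seqD[OF assms]
  by (intro exI[of _ D])
     (simp add: has_real_derivative_iff_has_vector_derivative has_vector_derivative_at_within)

subsection \<open>Exponentials of smooth functions\<close>

lemma sum_Leibniz_Suc: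
  fixes f g :: "nat \<Rightarrow> 'a::comm_semiring_1"
  shows "(\<Sum>i\<le>k. of_nat (k choose i) * (f i * g (Suc k - i) + f (Suc i) * g (k - i)))
    = (\<Sum>i\<le>Suc k. of_nat (Suc k choose i) * (f i * g (Suc k - i)))"
proof -
  have "(\<Sum>i\<le>k. of_nat (k choose i) * (f i * g (Suc k - i)))
      = (\<Sum>i\<le>Suc k. of_nat (k choose i) * (f i * g (Suc k - i)))"
    by (simp add: binomial_eq_0)
  also have "\<dots> = f 0 * g (Suc k) + (\<Sum>i\<le>k. of_nat (k choose Suc i) * (f (Suc i) * g (k - i)))"
    by (subst sum.atMost_Suc_shift) simp
  finally show ?thesis
    by (subst sum.atMost_Suc_shift) (simp add: sum.distrib distrib_left distrib_right add_ac)
qed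

lemma has_vector_derivative_Leibniz_sum:
  fixes f g :: "nat \<Rightarrow> real \<Rightarrow> 'a::real_normed_field"
  assumes "\<And>i. i \<le> k \<Longrightarrow> (f i has_vector_derivative f (Suc i) t) (at t)"
    and "\<And>i. i \<le> k \<Longrightarrow> (g i has_vector_derivative g (Suc i) t) (at t)"
  shows "((\<lambda>t. \<Sum>i\<le>k. of_nat (k choose i) * (f i t * g (k - i) t)) has_vector_derivative
    (\<Sum>i\<le>Suc k. of_nat (Suc k choose i) * (f i t * g (Suc k - i) t))) (at t)"
  unfolding sum_Leibniz_Suc[of k "\<lambda>i. f i t" "\<lambda>i. g i t", symmetric]
proof (intro has_vector_derivative_sum has_vector_derivative_mult_right)
  fix i assume "i \<in> {..k}"
  then show "((\<lambda>t. f i t * g (k - i) t) has_vector_derivative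
      f i t * g (Suc k - i) t + f (Suc i) t * g (k - i) t) (at t)"
    using has_vector_derivative_mult[OF assms(1)[of i] assms(2)[of "k - i"]]
    by (simp add: Suc_diff_le)
qed

text \<open>The recursion is Leibniz' rule applied to \<open>E' = E G'\<close>, where \<open>E = exp \<circ> G\<close>.\<close>

fun exp_derivs :: "(nat \<Rightarrow> real \<Rightarrow> 'a::{banach, real_normed_field}) \<Rightarrow> nat \<Rightarrow> real \<Rightarrow> 'a" where
  "exp_derivs G 0 t = exp (G 0 t)"
| "exp_derivs G (Suc k) t =
     (\<Sum>i\<le>k. of_nat (k choose i) * (exp_derivs G i t * G (Suc (k - i)) t))"

lemma deriv_seq_exp_derivs:
  assumes "deriv_seq G"
  shows "deriv_seq (exp_derivs G)"
  unfolding deriv_seq_def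
proof (intro allI)
  fix k t
  show "(exp_derivs G k has_vector_derivative exp_derivs G (Suc k) t) (at t)"
  proof (induction k rule: less_induct)
    case (less k)
    show ?case
    proof (cases k)
      case 0
      have "exp_derivs G 0 = exp \<circ> G 0"
        by (simp add: fun_eq_iff)
      then show ?thesis
        using field_vector_diff_chain_at[OF deriv_seqD[OF assms] DERIV_exp] 0
        by (simp add: o_def mult.commute)
    next
      case (Suc m)
      show ?thesis
        unfolding Suc exp_derivs.simps(2)[abs_def, of G m] exp_derivs.simps(2)[of G "Suc m"]
        using deriv_seqD[OF assms]
        by (intro has_vector_derivative_Leibniz_sum[where g = "\<lambda>j. G (Suc j)"])
           (simp_all only: less.IH Suc less_Suc_eq_le)
    qed
  qed
qed

lemma norm_exp_derivs_le:
  assumes M_0: "M 0 = 1" and M_nonneg: "\<And>k. 0 \<le> M k"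
    and M_supermult: "\<And>n i. i \<le> n \<Longrightarrow> real (n choose i) * M i * M (n - i) \<le> M n"
    and exp_G: "norm (exp (G 0 t)) \<le> 1"
    and G: "\<And>k. norm (G (Suc k) t) \<le> C * M (Suc k)" and C: "0 \<le> C"
  shows "norm (exp_derivs G k t) \<le> (C + 1) ^ k * M k"
proof (induction k rule: less_induct)
  case (less k)
  show ?case
  proof (cases k)
    case 0
    then show ?thesis using exp_G by (simp add: M_0)
  next
    case (Suc m)
    have "norm (exp_derivs G (Suc m) t)
        \<le> (\<Sum>i\<le>m. real (m choose i) * (norm (exp_derivs G i t) * norm (G (Suc (m - i)) t)))"
      by (simp add: sum_norm_le norm_mult)
    also have "\<dots> \<le> (\<Sum>i\<le>m. C * (C + 1) ^ i * M (Suc m))"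
    proof (rule sum_mono)
      fix i assume "i \<in> {..m}"
      then have i: "i \<le> m" "i < k" using Suc by auto
      have "real (m choose i) * (norm (exp_derivs G i t) * norm (G (Suc (m - i)) t))
          \<le> real (Suc m choose i) * (((C + 1) ^ i * M i) * (C * M (Suc (m - i))))"
        using less.IH[OF i(2)] M_nonneg C
        by (intro mult_mono G mult_nonneg_nonneg) (auto intro: binomial_right_mono)
      also have "\<dots> = C * (C + 1) ^ i * (real (Suc m choose i) * M i * M (Suc m - i))"
        using i by (simp add: Suc_diff_le mult_ac)
      also have "\<dots> \<le> C * (C + 1) ^ i * M (Suc m)"
        using i C by (intro mult_left_mono M_supermult) auto
      finally show "real (m choose i) * (norm (exp_derivs G i t) * norm (G (Suc (m - i)) t))
          \<le> C * (C + 1) ^ i * M (Suc m)" .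
    qed
    also have "\<dots> = (C * (\<Sum>i\<le>m. (C + 1) ^ i)) * M (Suc m)"
      by (simp add: sum_distrib_left sum_distrib_right)
    also have "C * (\<Sum>i\<le>m. (C + 1) ^ i) = (C + 1) ^ Suc m - 1"
      using power_diff_1_eq[of "C + 1" "Suc m"] by (simp add: lessThan_Suc_atMost)
    also have "((C + 1) ^ Suc m - 1) * M (Suc m) \<le> (C + 1) ^ Suc m * M (Suc m)"
      using M_nonneg[of "Suc m"] by (intro mult_right_mono) auto
    finally show ?thesis unfolding Suc .
  qed
qed

subsection \<open>Smoothing by infinitely many box averages\<close>

definition unit_box :: "real measure" where
  "unit_box = restrict_space lborel {-1/2..1/2}"

lemma space_unit_box [simp]: "space unit_box = {-1/2..1/2}"
  by (simp add: unit_box_def space_restrict_space)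

lemma measurable_unit_box [measurable]: "(\<lambda>u. u) \<in> borel_measurable unit_box"
  unfolding unit_box_def by (rule measurable_restrict_space1) simp

interpretation unit_box: sequence_space unit_box
proof -
  have "prob_space unit_box"
    unfolding unit_box_def by (rule prob_space_restrict_space) auto
  then interpret prob_space unit_box .
  show "sequence_space unit_box"
    by unfold_locales
qed

definition box_average :: "real \<Rightarrow> (real \<Rightarrow> real) \<Rightarrow> real \<Rightarrow> real" where
  "box_average d f x = (\<integral>u. f (x + d * u) \<partial>unit_box)"

definition central_quotient :: "real \<Rightarrow> (real \<Rightarrow> real) \<Rightarrow> real \<Rightarrow> real" where
  "central_quotient d f x = (f (x + d / 2) - f (x - d / 2)) / d"

lemma has_real_derivative_central_quotient:
  assumes "\<And>x. (f has_real_derivative f' x) (at x)"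
  shows "(central_quotient d f has_real_derivative central_quotient d f' x) (at x)"
  unfolding central_quotient_def[abs_def] diff_conv_add_uminus[of x]
  by (intro DERIV_cdivide DERIV_diff; simp only: diff_conv_add_uminus DERIV_shift[symmetric] assms)

lemma abs_central_quotient_le:
  assumes "\<And>x. \<bar>f x\<bar> \<le> B" "d > 0"
  shows "\<bar>central_quotient d f x\<bar> \<le> 2 / d * B"
proof -
  have "\<bar>f (x + d / 2) - f (x - d / 2)\<bar> \<le> 2 * B"
    using assms(1)[of "x + d / 2"] assms(1)[of "x - d / 2"] by linarith
  then show ?thesis
    using assms(2) by (simp add: central_quotient_def divide_right_mono)
qed

lemma has_real_derivative_box_average:
  assumes f: "continuous_on UNIV f" and d: "d > 0"
  shows "(box_average d f has_real_derivative central_quotient d f x) (at x)"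
proof -
  have "isCont f y" for y
    using f by (simp add: continuous_on_eq_continuous_at)
  then obtain g where g: "\<And>y. (g has_real_derivative f y) (at y)"
    using einterval_antiderivative[of "-\<infinity>" \<infinity> f]
    by (auto simp: has_real_derivative_iff_has_vector_derivative)
  have "box_average d f y = central_quotient d g y" for y
  proof -
    have "((\<lambda>u. y + d * u) has_real_derivative d) (at u)" for u
      by (auto intro!: derivative_eq_intros)
    from DERIV_cdivide[OF DERIV_chain2[OF g this], of d]
    have "((\<lambda>u. g (y + d * u) / d) has_real_derivative f (y + d * u)) (at u)" for u
      using d by simp
    moreover have "isCont (\<lambda>u. f (y + d * u)) u" for u
      by (intro continuous_intros isCont_o2[OF _ \<open>isCont f _\<close>])
    ultimately show ?thesis
      using integral_FTC_Icc_real[of "-1/2" "1/2" "\<lambda>u. g (y + d * u) / d" "\<lambda>u. f (y + d * u)"]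
      by (simp add: box_average_def unit_box_def integral_restrict_space central_quotient_def
          mult.commute diff_divide_distrib)
  qed
  then have "box_average d f = central_quotient d g" ..
  then show ?thesis
    using has_real_derivative_central_quotient[OF g] by simp
qed

locale box_smoothing =
  fixes \<delta> :: "nat \<Rightarrow> real" and \<phi> :: "real \<Rightarrow> real" and B :: real
  assumes width_pos: "\<And>j. \<delta> j > 0" and width_summable: "summable \<delta>"
    and cont: "continuous_on UNIV \<phi>" and bounded: "\<And>x. \<bar>\<phi> x\<bar> \<le> B"
begin

text \<open>
  The coordinates of \<open>\<omega>\<close> are renumbered from \<open>0\<close> at every stage \<open>k\<close>, so that all stages share one
  product space and splitting off the first coordinate leads from stage \<open>k\<close> to stage \<open>Suc k\<close>.
\<close>

definition shift :: "nat \<Rightarrow> (nat \<Rightarrow> real) \<Rightarrow> real" where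
  "shift k \<omega> = (\<Sum>j. \<delta> (j + k) * \<omega> j)"

definition smoothed :: "nat \<Rightarrow> real \<Rightarrow> real" where
  "smoothed k x = (\<integral>\<omega>. \<phi> (x + shift k \<omega>) \<partial>unit_box.S)"

lemma abs_coordinate_le: "\<omega> \<in> space unit_box.S \<Longrightarrow> \<bar>\<omega> j\<bar> \<le> 1 / 2"
  by (auto simp: space_PiM PiE_iff abs_le_iff dest: spec[of _ j])

lemma abs_shift_term_le:
  assumes "\<omega> \<in> space unit_box.S"
  shows "\<bar>\<delta> (j + k) * \<omega> j\<bar> \<le> \<delta> (j + k) / 2"
  using mult_left_mono[OF abs_coordinate_le[OF assms, of j], of "\<delta> (j + k)"] width_pos[of "j + k"]
  by (simp add: abs_mult)

lemma summable_shift_bound: "summable (\<lambda>j. \<delta> (j + k) / 2)"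
  by (intro summable_divide summable_ignore_initial_segment width_summable)

lemma summable_shift:
  assumes "\<omega> \<in> space unit_box.S"
  shows "summable (\<lambda>j. \<delta> (j + k) * \<omega> j)"
  using abs_shift_term_le[OF assms]
  by (intro summable_comparison_test'[OF summable_shift_bound]) auto

lemma abs_shift_0_le:
  assumes "\<omega> \<in> space unit_box.S"
  shows "\<bar>shift 0 \<omega>\<bar> \<le> suminf \<delta> / 2"
proof -
  have "norm (shift 0 \<omega>) \<le> (\<Sum>j. \<delta> (j + 0) / 2)"
    unfolding shift_def using abs_shift_term_le[OF assms, of _ 0]
    by (intro norm_suminf_le summable_shift_bound[of 0]) simp_all
  then show ?thesis
    using suminf_divide[OF width_summable] by simp
qed

lemma shift_case_nat:
  assumes "u \<in> space unit_box" "\<omega> \<in> space unit_box.S"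
  shows "shift k (case_nat u \<omega>) = \<delta> k * u + shift (Suc k) \<omega>"
proof -
  have "case_nat u \<omega> \<in> space unit_box.S"
    using assms by (auto simp: space_PiM PiE_iff split: nat.split)
  from suminf_split_head[OF summable_shift[OF this, of k]] show ?thesis
    by (simp add: shift_def)
qed

lemma measurable_shift [measurable]: "shift k \<in> borel_measurable unit_box.S"
proof -
  have [measurable]: "(\<lambda>\<omega>. \<omega> j) \<in> borel_measurable unit_box.S" for j
    using measurable_component_singleton[of j UNIV "\<lambda>_. unit_box"]
    by (intro measurable_compose[OF _ measurable_unit_box]) simp
  show ?thesis
    unfolding shift_def[abs_def] by measurable
qed

lemma measurable_\<phi> [measurable]: "\<phi> \<in> borel_measurable borel"
  using cont by (rule borel_measurable_continuous_onI)

lemma abs_smoothed_le: "\<bar>smoothed k x\<bar> \<le> B"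
proof -
  have "\<bar>smoothed k x\<bar> \<le> (\<integral>\<omega>. \<bar>\<phi> (x + shift k \<omega>)\<bar> \<partial>unit_box.S)"
    unfolding smoothed_def by (rule integral_abs_bound)
  also have "\<dots> \<le> B"
    by (intro unit_box.P.integral_le_const unit_box.P.integrable_const_bound[of _ B])
       (simp_all add: bounded)
  finally show ?thesis .
qed

lemma continuous_smoothed: "continuous_on UNIV (smoothed k)"
proof -
  have "isCont (smoothed k) x" for x
    unfolding continuous_at_sequentially comp_def smoothed_def
  proof (intro allI impI)
    fix X :: "nat \<Rightarrow> real" assume X: "X \<longlonglongrightarrow> x"
    have "(\<lambda>n. \<phi> (X n + shift k \<omega>)) \<longlonglongrightarrow> \<phi> (x + shift k \<omega>)" for \<omega>
      using cont X by (intro isCont_tendsto_compose[of _ \<phi>] tendsto_intros)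
         (simp_all add: continuous_on_eq_continuous_at)
    then show "(\<lambda>n. \<integral>\<omega>. \<phi> (X n + shift k \<omega>) \<partial>unit_box.S)
        \<longlonglongrightarrow> (\<integral>\<omega>. \<phi> (x + shift k \<omega>) \<partial>unit_box.S)"
      by (intro integral_dominated_convergence[where w = "\<lambda>_. B"]) (auto simp: bounded)
  qed
  then show ?thesis by (simp add: continuous_at_imp_continuous_on)
qed

lemma smoothed_eq_box_average: "smoothed k = box_average (\<delta> k) (smoothed (Suc k))"
proof
  fix x
  interpret UP: pair_prob_space unit_box unit_box.S ..
  let ?N = "unit_box \<Otimes>\<^sub>M unit_box.S"
  have "smoothed k x = (\<integral>\<omega>. \<phi> (x + shift k \<omega>) \<partial>distr ?N unit_box.S (\<lambda>(u, \<omega>). case_nat u \<omega>))"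
    by (simp add: smoothed_def unit_box.PiM_iter)
  also have "\<dots> = (\<integral>p. \<phi> (x + shift k (case p of (u, \<omega>) \<Rightarrow> case_nat u \<omega>)) \<partial>?N)"
    by (rule integral_distr) measurable
  also have "\<dots> = (\<integral>(u, \<omega>). \<phi> (x + \<delta> k * u + shift (Suc k) \<omega>) \<partial>?N)"
    by (rule Bochner_Integration.integral_cong)
       (auto simp: space_pair_measure shift_case_nat add.assoc)
  also have "\<dots> = (\<integral>u. \<integral>\<omega>. \<phi> (x + \<delta> k * u + shift (Suc k) \<omega>) \<partial>unit_box.S \<partial>unit_box)"
    by (rule UP.integral_fst'[symmetric,
          of "\<lambda>(u, \<omega>). \<phi> (x + \<delta> k * u + shift (Suc k) \<omega>)", simplified])
       (auto simp: bounded intro!: UP.integrable_const_bound[of _ B])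
  also have "\<dots> = box_average (\<delta> k) (smoothed (Suc k)) x"
    by (simp add: box_average_def smoothed_def)
  finally show "smoothed k x = box_average (\<delta> k) (smoothed (Suc k)) x" .
qed

lemma smoothed_0_eq_const:
  assumes "\<And>y. \<bar>y - x\<bar> \<le> suminf \<delta> / 2 \<Longrightarrow> \<phi> y = c"
  shows "smoothed 0 x = c"
proof -
  have "smoothed 0 x = (\<integral>\<omega>. c \<partial>unit_box.S)"
    unfolding smoothed_def
    using abs_shift_0_le by (intro Bochner_Integration.integral_cong assms) simp_all
  then show ?thesis by (simp add: unit_box.P.prob_space)
qed

primrec quotients :: "nat \<Rightarrow> (real \<Rightarrow> real) \<Rightarrow> real \<Rightarrow> real" where
  "quotients 0 f = f"
| "quotients (Suc k) f = quotients k (central_quotient (\<delta> k) f)"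

lemma has_real_derivative_quotients:
  assumes "\<And>x. (f has_real_derivative f' x) (at x)"
  shows "(quotients k f has_real_derivative quotients k f' x) (at x)"
  using assms by (induction k arbitrary: f f') (simp_all add: has_real_derivative_central_quotient)

lemma abs_quotients_le:
  assumes "\<And>x. \<bar>f x\<bar> \<le> b"
  shows "\<bar>quotients k f x\<bar> \<le> (\<Prod>j<k. 2 / \<delta> j) * b"
  using assms
proof (induction k arbitrary: f b)
  case (Suc k)
  from Suc.IH[OF abs_central_quotient_le[OF Suc.prems width_pos]] show ?case
    by (simp add: mult_ac)
qed simp

lemma deriv_seq_quotients_smoothed: "deriv_seq (\<lambda>k. quotients k (smoothed k))"
proof -
  have "(smoothed k has_real_derivative central_quotient (\<delta> k) (smoothed (Suc k)) x) (at x)" for k x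
    unfolding smoothed_eq_box_average[of k]
    by (rule has_real_derivative_box_average[OF continuous_smoothed width_pos])
  then have "(quotients k (smoothed k) has_real_derivative
      quotients (Suc k) (smoothed (Suc k)) t) (at t)" for k t
    by (simp add: has_real_derivative_quotients)
  then show ?thesis
    by (simp only: deriv_seq_def has_real_derivative_iff_has_vector_derivative) simp
qed

lemma exists_smoothing:
  "\<exists>D. deriv_seq D \<and> (\<forall>k t. \<bar>D k t\<bar> \<le> (\<Prod>j<k. 2 / \<delta> j) * B)
     \<and> (\<forall>t c. (\<forall>y. \<bar>y - t\<bar> \<le> suminf \<delta> / 2 \<longrightarrow> \<phi> y = c) \<longrightarrow> D 0 t = c)"
  using deriv_seq_quotients_smoothed abs_quotients_le[OF abs_smoothed_le] smoothed_0_eq_const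
  by (intro exI[of _ "\<lambda>k. quotients k (smoothed k)"]) simp

end

subsection \<open>Logarithmic weights\<close>

definition log_power :: "real \<Rightarrow> real \<Rightarrow> real" where
  "log_power \<epsilon> x = ln (exp 1 + x) powr (1 + \<epsilon>)"

definition log_weight :: "real \<Rightarrow> nat \<Rightarrow> real" where
  "log_weight \<epsilon> k = fact k * (\<Prod>j=1..k. log_power \<epsilon> (real j))"

lemma ln_exp1_add_ge_1: "0 \<le> x \<Longrightarrow> 1 \<le> ln (exp 1 + x)" for x :: real
  using ln_le_cancel_iff[of "exp 1" "exp 1 + x"] by (simp add: add_pos_nonneg)

lemma log_power_ge_1: "0 \<le> \<epsilon> \<Longrightarrow> 0 \<le> x \<Longrightarrow> 1 \<le> log_power \<epsilon> x"
  by (simp add: log_power_def ge_one_powr_ge_zero ln_exp1_add_ge_1)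

lemma log_power_mono:
  assumes "0 \<le> \<epsilon>" "0 \<le> x" "x \<le> y"
  shows "log_power \<epsilon> x \<le> log_power \<epsilon> y"
  unfolding log_power_def
proof (rule powr_mono2)
  show "0 \<le> ln (exp 1 + x)"
    using ln_exp1_add_ge_1[OF assms(2)] by linarith
qed (use assms in \<open>simp_all add: add_pos_nonneg\<close>)

lemma log_weight_nonneg: "0 \<le> log_weight \<epsilon> k"
  by (simp add: log_weight_def log_power_def prod_nonneg)

lemma log_weight_0: "log_weight \<epsilon> 0 = 1"
  by (simp add: log_weight_def)

lemma log_weight_eq_prod: "log_weight \<epsilon> k = (\<Prod>j<k. real (Suc j) * log_power \<epsilon> (real (Suc j)))"
  by (simp add: log_weight_def fact_prod_Suc prod.distrib prod.atLeast1_atMost_eq atLeast0LessThan)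

lemma prod_log_power_mult_le:
  assumes "0 \<le> \<epsilon>" "i \<le> n"
  shows "(\<Prod>j=1..i. log_power \<epsilon> (real j)) * (\<Prod>j=1..n - i. log_power \<epsilon> (real j))
    \<le> (\<Prod>j=1..n. log_power \<epsilon> (real j))"
proof -
  let ?P = "\<lambda>A. \<Prod>j\<in>A. log_power \<epsilon> (real j)"
  have "?P {1..i} \<le> (\<Prod>j=1..i. log_power \<epsilon> (real (j + (n - i))))"
    using assms(1) by (intro prod_mono conjI log_power_mono) (auto simp: log_power_def)
  also have "\<dots> = ?P {n - i + 1..n}"
    using prod.shift_bounds_cl_nat_ivl[of "\<lambda>j. log_power \<epsilon> (real j)" 1 "n - i" i] assms(2)
    by (simp add: add.commute)
  finally have "?P {1..i} * ?P {1..n - i} \<le> ?P {n - i + 1..n} * ?P {1..n - i}"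
    by (rule mult_right_mono) (simp add: log_power_def prod_nonneg)
  also have "\<dots> = ?P {1..n}"
    using prod.ub_add_nat[of 1 "n - i" "\<lambda>j. log_power \<epsilon> (real j)" i] assms(2)
    by (simp add: mult.commute)
  finally show ?thesis .
qed

lemma binomial_log_weight_mult_le:
  assumes "0 \<le> \<epsilon>" "0 \<le> A" "i \<le> n"
  shows "real (n choose i) * (A ^ i * log_weight \<epsilon> i) * (A ^ (n - i) * log_weight \<epsilon> (n - i))
    \<le> A ^ n * log_weight \<epsilon> n"
proof -
  let ?P = "\<lambda>k. \<Prod>j=1..k. log_power \<epsilon> (real j)"
  have "real (n choose i) * (A ^ i * log_weight \<epsilon> i) * (A ^ (n - i) * log_weight \<epsilon> (n - i))
      = (A ^ i * A ^ (n - i)) * (fact i * fact (n - i) * real (n choose i)) * (?P i * ?P (n - i))"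
    by (simp add: log_weight_def mult_ac)
  also have "A ^ i * A ^ (n - i) = A ^ n"
    using assms(3) by (simp flip: power_add)
  also have "fact i * fact (n - i) * real (n choose i) = fact n"
    using arg_cong[OF binomial_fact_lemma[OF assms(3)], of real] by simp
  also have "A ^ n * fact n * (?P i * ?P (n - i)) \<le> A ^ n * fact n * ?P n"
    using assms prod_log_power_mult_le by (intro mult_left_mono) auto
  finally show ?thesis
    by (simp add: log_weight_def mult.assoc)
qed

lemma log_weight_le_power:
  assumes "0 \<le> \<epsilon>" "real k \<le> q"
  shows "log_weight \<epsilon> k \<le> (real k * log_power \<epsilon> q) ^ k"
proof -
  have "log_weight \<epsilon> k \<le> (\<Prod>j<k. real k * log_power \<epsilon> q)"
    unfolding log_weight_eq_prod using assms
    by (intro prod_mono conjI mult_mono log_power_mono) (auto simp: log_power_def)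
  then show ?thesis by simp
qed

subsection \<open>Cutoff functions\<close>

definition log_smooth :: "real \<Rightarrow> real \<Rightarrow> (nat \<Rightarrow> real \<Rightarrow> real) \<Rightarrow> bool" where
  "log_smooth A \<epsilon> D \<longleftrightarrow> deriv_seq D \<and> (\<forall>k t. \<bar>D k t\<bar> \<le> A ^ k * log_weight \<epsilon> k)"

definition even_cutoff :: "(real \<Rightarrow> real) \<Rightarrow> bool" where
  "even_cutoff f \<longleftrightarrow> (\<forall>t. f (- t) = f t) \<and> (\<forall>t. 2 \<le> \<bar>t\<bar> \<longrightarrow> f t = 0)"

lemma log_smooth_mono:
  assumes "log_smooth A \<epsilon> D" "0 \<le> A" "A \<le> A'"
  shows "log_smooth A' \<epsilon> D"
proof -
  have "A ^ k * log_weight \<epsilon> k \<le> A' ^ k * log_weight \<epsilon> k" for k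
    using assms log_weight_nonneg by (intro mult_right_mono power_mono)
  with assms(1) show ?thesis
    unfolding log_smooth_def using order_trans by blast
qed

lemma exists_bump:
  assumes pos: "\<And>j. \<delta> j > 0" and "summable \<delta>" and total: "suminf \<delta> \<le> 1 / 2"
  shows "\<exists>D. deriv_seq D \<and> (\<forall>k t. \<bar>D k t\<bar> \<le> (\<Prod>j<k. 2 / \<delta> j))
    \<and> even_cutoff (D 0) \<and> (\<forall>t. \<bar>t\<bar> \<le> 1 \<longrightarrow> D 0 t = 1)"
proof -
  define \<phi> where "\<phi> x = max 0 (min 1 (7 / 2 - 2 * \<bar>x\<bar>))" for x :: real
  have "box_smoothing \<delta> \<phi> 1"
    using assms by unfold_locales (auto simp: \<phi>_def intro!: continuous_intros)
  from box_smoothing.exists_smoothing[OF this] obtain D where D: "deriv_seq D"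
    and D_le: "\<And>k t. \<bar>D k t\<bar> \<le> (\<Prod>j<k. 2 / \<delta> j)"
    and D_const: "\<And>t c. (\<And>y. \<bar>y - t\<bar> \<le> suminf \<delta> / 2 \<Longrightarrow> \<phi> y = c) \<Longrightarrow> D 0 t = c"
    by auto
  \<comment> \<open>Taking the even part avoids proving that the product measure is symmetric.\<close>
  define E where "E k t = (D k t + (- 1) ^ k *\<^sub>R D k (- t)) /\<^sub>R 2" for k t
  have "deriv_seq E"
    unfolding E_def by (rule deriv_seq_even_part[OF D])
  moreover have "\<bar>E k t\<bar> \<le> (\<Prod>j<k. 2 / \<delta> j)" for k t
    using D_le[of k t] D_le[of k "- t"] abs_triangle_ineq[of "D k t" "(- 1) ^ k * D k (- t)"]
    by (simp add: E_def abs_mult)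
  moreover have "D 0 t = 1" if "\<bar>t\<bar> \<le> 1" for t
  proof (rule D_const)
    fix y assume "\<bar>y - t\<bar> \<le> suminf \<delta> / 2"
    with that total have "\<bar>y\<bar> \<le> 5 / 4" by linarith
    then show "\<phi> y = 1" by (simp add: \<phi>_def)
  qed
  moreover have "D 0 t = 0" if "2 \<le> \<bar>t\<bar>" for t
  proof (rule D_const)
    fix y assume "\<bar>y - t\<bar> \<le> suminf \<delta> / 2"
    with that total have "7 / 4 \<le> \<bar>y\<bar>" by linarith
    then show "\<phi> y = 0" by (simp add: \<phi>_def)
  qed
  ultimately show ?thesis
    by (intro exI[of _ E]) (simp add: even_cutoff_def E_def add.commute)
qed

definition log_width :: "real \<Rightarrow> nat \<Rightarrow> real" where
  "log_width \<epsilon> j = (ln (exp 1 + real j) powr - \<epsilon> - ln (exp 1 + real (Suc j)) powr - \<epsilon>) / 2"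

lemma ln_powr_diff_ge:
  fixes a \<epsilon> :: real
  assumes "0 < \<epsilon>" "1 < a"
  shows "\<epsilon> / ((a + 1) * ln (a + 1) powr (1 + \<epsilon>)) \<le> ln a powr - \<epsilon> - ln (a + 1) powr - \<epsilon>"
proof -
  have "((\<lambda>x. - (ln x powr - \<epsilon>)) has_real_derivative \<epsilon> / (x * ln x powr (1 + \<epsilon>))) (at x)"
    if "a \<le> x" for x
  proof -
    have "ln x powr (- \<epsilon> - 1) = 1 / ln x powr (1 + \<epsilon>)"
      using powr_minus_divide[of "ln x" "1 + \<epsilon>"] by (simp add: minus_diff_commute)
    then show ?thesis
      using DERIV_minus[OF DERIV_fun_powr[OF DERIV_ln_divide, of x "- \<epsilon>"]] that assms
      by (simp add: mult.commute)
  qed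
  from MVT2[of a "a + 1", OF _ this] obtain z where z: "a < z" "z < a + 1"
    and eq: "ln a powr - \<epsilon> - ln (a + 1) powr - \<epsilon> = \<epsilon> / (z * ln z powr (1 + \<epsilon>))"
    by auto
  have "z * ln z powr (1 + \<epsilon>) \<le> (a + 1) * ln (a + 1) powr (1 + \<epsilon>)"
    using z assms by (intro mult_mono powr_mono2) auto
  then show ?thesis
    unfolding eq using z assms by (intro divide_left_mono mult_pos_pos) auto
qed

lemma log_width_ge:
  assumes "0 < \<epsilon>"
  shows "\<epsilon> \<le> 8 * (real (Suc j) * log_power \<epsilon> (real (Suc j))) * log_width \<epsilon> j"
proof -
  let ?L = "log_power \<epsilon> (real (Suc j))"
  have "1 \<le> ?L"
    using assms by (intro log_power_ge_1) auto
  have "1 < exp 1 + real j"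
    using one_less_exp_iff[of "1 :: real"] by linarith
  have "exp 1 + real j + 1 \<le> 4 * real (Suc j)"
    using exp_le by simp
  then have "\<epsilon> / (4 * real (Suc j) * ?L) \<le> \<epsilon> / ((exp 1 + real j + 1) * ?L)"
    using assms \<open>1 \<le> ?L\<close> \<open>1 < exp 1 + real j\<close>
    by (intro divide_left_mono mult_right_mono mult_pos_pos) auto
  also have "\<dots> \<le> 2 * log_width \<epsilon> j"
    using ln_powr_diff_ge[OF assms \<open>1 < exp 1 + real j\<close>]
    by (simp add: log_width_def log_power_def add_ac diff_divide_distrib)
  finally show ?thesis
    using \<open>1 \<le> ?L\<close> by (simp add: pos_divide_le_eq mult_ac del: of_nat_Suc)
qed

lemma log_width_sums:
  assumes "0 < \<epsilon>"
  shows "log_width \<epsilon> sums (1 / 2)"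
proof -
  have "(\<lambda>j. ln (exp 1 + real j) powr - \<epsilon>) \<longlonglongrightarrow> 0"
    using assms
    by (intro tendsto_neg_powr filterlim_compose[OF ln_at_top]
        filterlim_tendsto_add_at_top[OF tendsto_const] filterlim_real_sequentially) simp
  from sums_divide[OF telescope_sums'[OF this], of 2] show ?thesis
    by (simp add: log_width_def[abs_def])
qed

lemma exists_log_smooth_bump:
  assumes "0 < \<epsilon>"
  shows "\<exists>D. log_smooth (16 / \<epsilon>) \<epsilon> D \<and> even_cutoff (D 0) \<and> (\<forall>t. \<bar>t\<bar> \<le> 1 \<longrightarrow> D 0 t = 1)"
proof -
  define w where "w j = real (Suc j) * log_power \<epsilon> (real (Suc j))" for j
  have width_ge: "\<epsilon> \<le> 8 * w j * log_width \<epsilon> j" for j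
    unfolding w_def by (rule log_width_ge[OF assms])
  have "0 < w j" for j
    using log_power_ge_1[of \<epsilon> "real (Suc j)"] assms by (simp add: w_def)
  then have width_pos: "0 < log_width \<epsilon> j" for j
    using zero_less_mult_pos[OF less_le_trans[OF assms width_ge]] by simp
  have "(\<Prod>j<k. 2 / log_width \<epsilon> j) \<le> (16 / \<epsilon>) ^ k * log_weight \<epsilon> k" for k
  proof -
    have "2 / log_width \<epsilon> j \<le> 16 / \<epsilon> * w j" for j
      using width_ge[of j] width_pos[of j] assms by (simp add: field_simps)
    then have "(\<Prod>j<k. 2 / log_width \<epsilon> j) \<le> (\<Prod>j<k. 16 / \<epsilon> * w j)"
      using width_pos by (intro prod_mono) (auto intro: less_imp_le)
    also have "\<dots> = (16 / \<epsilon>) ^ k * log_weight \<epsilon> k"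
      by (simp only: w_def log_weight_eq_prod prod.distrib prod_constant card_lessThan)
    finally show ?thesis .
  qed
  moreover obtain D where "deriv_seq D" "\<And>k t. \<bar>D k t\<bar> \<le> (\<Prod>j<k. 2 / log_width \<epsilon> j)"
      "even_cutoff (D 0)" "\<forall>t. \<bar>t\<bar> \<le> 1 \<longrightarrow> D 0 t = 1"
    using exists_bump[of "log_width \<epsilon>", OF width_pos] log_width_sums[OF assms]
    by (auto simp: sums_iff)
  ultimately show ?thesis
    unfolding log_smooth_def using order_trans by (intro exI[of _ D]) blast
qed

definition dyadic_cutoff :: "(real \<Rightarrow> real) \<Rightarrow> real \<Rightarrow> real" where
  "dyadic_cutoff b t = sin (pi / 2 * (b t - b (2 * t)))"

lemma even_cutoff_dyadic_cutoff: "even_cutoff b \<Longrightarrow> even_cutoff (dyadic_cutoff b)"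
  by (simp add: even_cutoff_def dyadic_cutoff_def abs_mult)

lemma admissible_c_dyadic_cutoff:
  assumes "smooth_nonneg (dyadic_cutoff b)" "even_cutoff b" and b_inner: "\<And>t. \<bar>t\<bar> \<le> 1 \<Longrightarrow> b t = 1"
  shows "admissible_c (dyadic_cutoff b)"
proof -
  have b_outer: "b t = 0" if "2 \<le> \<bar>t\<bar>" for t
    using assms(2) that by (simp add: even_cutoff_def)
  have "(dyadic_cutoff b t)\<^sup>2 + (dyadic_cutoff b (t / 2))\<^sup>2 = 1" if "t \<in> {1..2}" for t
    using that by (simp add: dyadic_cutoff_def b_inner b_outer right_diff_distrib sin_diff)
  moreover have "dyadic_cutoff b t = 0" if "0 \<le> t" "t \<notin> {1/2..2}" for t
    using that by (auto simp: dyadic_cutoff_def b_inner b_outer)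
  ultimately show ?thesis
    using assms(1) by (simp add: admissible_c_def)
qed

lemma log_smooth_sin:
  assumes g: "deriv_seq g" and g_le: "\<And>k t. \<bar>g k t\<bar> \<le> C * (A ^ k * log_weight \<epsilon> k)"
    and "0 \<le> C" "0 \<le> A" "0 \<le> \<epsilon>"
  shows "\<exists>E. E 0 = (\<lambda>t. sin (g 0 t)) \<and> log_smooth ((C + 1) * A) \<epsilon> E"
proof -
  define G where "G k t = \<i> * complex_of_real (g k t)" for k t
  have "deriv_seq G"
    unfolding G_def
    by (intro deriv_seq_bounded_linear[OF bounded_linear_mult_right]
        deriv_seq_bounded_linear[OF bounded_linear_of_real] g)
  then have "deriv_seq (\<lambda>k t. Im (exp_derivs G k t))"
    by (intro deriv_seq_bounded_linear[OF bounded_linear_Im] deriv_seq_exp_derivs)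
  moreover have "\<bar>Im (exp_derivs G k t)\<bar> \<le> ((C + 1) * A) ^ k * log_weight \<epsilon> k" for k t
  proof -
    have "norm (exp_derivs G k t) \<le> (C + 1) ^ k * (A ^ k * log_weight \<epsilon> k)"
    proof (rule norm_exp_derivs_le[where M = "\<lambda>k. A ^ k * log_weight \<epsilon> k"])
      show "norm (G (Suc k) t) \<le> C * (A ^ Suc k * log_weight \<epsilon> (Suc k))" for k
        using g_le[of "Suc k" t] by (simp only: G_def norm_mult norm_ii norm_of_real mult_1_left)
    qed (use assms in \<open>simp_all add: G_def log_weight_0 log_weight_nonneg
        binomial_log_weight_mult_le\<close>)
    with abs_Im_le_cmod[of "exp_derivs G k t"] show ?thesis
      by (simp add: power_mult_distrib mult.assoc)
  qed
  moreover have "(\<lambda>t. Im (exp_derivs G 0 t)) = (\<lambda>t. sin (g 0 t))"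
    by (simp add: fun_eq_iff Im_exp G_def)
  ultimately show ?thesis
    unfolding log_smooth_def by (intro exI[of _ "\<lambda>k t. Im (exp_derivs G k t)"]) blast
qed

lemma log_smooth_dyadic_cutoff:
  assumes D: "log_smooth A \<epsilon> D" and "0 \<le> A" "0 \<le> \<epsilon>"
  shows "\<exists>E. E 0 = dyadic_cutoff (D 0) \<and> log_smooth (10 * A) \<epsilon> E"
proof -
  define g where "g k t = pi / 2 * (D k t - 2 ^ k *\<^sub>R D k (2 * t + 0))" for k t
  have D_derivs: "deriv_seq D" and D_le: "\<And>k t. \<bar>D k t\<bar> \<le> A ^ k * log_weight \<epsilon> k"
    using D by (auto simp: log_smooth_def)
  have "deriv_seq g"
    unfolding g_def
    by (intro deriv_seq_bounded_linear[OF bounded_linear_mult_right] deriv_seq_diff deriv_seq_affine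
        D_derivs)
  moreover have "\<bar>g k t\<bar> \<le> 4 * ((2 * A) ^ k * log_weight \<epsilon> k)" for k t
  proof -
    have "\<bar>D k t - 2 ^ k * D k (2 * t)\<bar> \<le> 1 * \<bar>D k t\<bar> + 2 ^ k * \<bar>D k (2 * t)\<bar>"
      using abs_triangle_ineq4[of "D k t" "2 ^ k * D k (2 * t)"] by (simp add: abs_mult)
    also have "\<dots> \<le> 2 ^ k * (A ^ k * log_weight \<epsilon> k) + 2 ^ k * (A ^ k * log_weight \<epsilon> k)"
      by (intro add_mono mult_mono D_le) auto
    finally have "pi / 2 * \<bar>D k t - 2 ^ k * D k (2 * t)\<bar> \<le> 2 * (2 * ((2 * A) ^ k * log_weight \<epsilon> k))"
      using pi_less_4 by (intro mult_mono) (auto simp: power_mult_distrib mult_ac)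
    then show ?thesis
      by (simp add: g_def abs_mult)
  qed
  ultimately have "\<exists>E. E 0 = (\<lambda>t. sin (g 0 t)) \<and> log_smooth ((4 + 1) * (2 * A)) \<epsilon> E"
    using assms(2,3) by (intro log_smooth_sin) auto
  moreover have "(\<lambda>t. sin (g 0 t)) = dyadic_cutoff (D 0)"
    by (simp add: fun_eq_iff g_def dyadic_cutoff_def)
  ultimately show ?thesis by simp
qed

lemma exists_log_smooth_cutoff:
  assumes "0 < \<epsilon>" "adm \<in> {admissible_a, admissible_b, admissible_c}"
  shows "\<exists>D. log_smooth (160 / \<epsilon>) \<epsilon> D \<and> even_cutoff (D 0) \<and> adm (D 0)"
proof -
  obtain D where D: "log_smooth (16 / \<epsilon>) \<epsilon> D" "even_cutoff (D 0)" "\<And>t. \<bar>t\<bar> \<le> 1 \<Longrightarrow> D 0 t = 1"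
    using exists_log_smooth_bump[OF assms(1)] by blast
  obtain E where E: "E 0 = dyadic_cutoff (D 0)" "log_smooth (160 / \<epsilon>) \<epsilon> E"
    using log_smooth_dyadic_cutoff[OF D(1)] assms(1) by auto
  have "smooth_nonneg (D 0)" "smooth_nonneg (E 0)"
    using D(1) E(2) by (auto simp: log_smooth_def intro: deriv_seq_imp_smooth_nonneg)
  then have "admissible_a (D 0)" "admissible_c (E 0)"
    using D E(1) by (auto simp: admissible_a_def even_cutoff_def intro: admissible_c_dyadic_cutoff)
  moreover have "admissible_b (E 0)"
    using \<open>admissible_c (E 0)\<close> by (simp add: admissible_b_def admissible_c_def)
  moreover have "log_smooth (160 / \<epsilon>) \<epsilon> D"
    using assms(1) by (intro log_smooth_mono[OF D(1)]) (auto simp: divide_right_mono)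
  moreover have "even_cutoff (E 0)"
    unfolding E(1) using D(2) by (rule even_cutoff_dyadic_cutoff)
  ultimately show ?thesis
    using assms(2) D(2) E(2) by blast
qed

subsection \<open>Trigonometric sums with smooth coefficients\<close>

definition backward_diff :: "(real \<Rightarrow> 'a::ab_group_add) \<Rightarrow> real \<Rightarrow> 'a" where
  "backward_diff f t = f t - f (t - 1)"

lemma deriv_seq_backward_diff:
  assumes "deriv_seq D"
  shows "deriv_seq (\<lambda>k. backward_diff (D k))"
  using deriv_seq_diff[OF assms deriv_seq_affine[OF assms, of 1 "-1"]]
  by (simp add: backward_diff_def[abs_def])

lemma norm_backward_diff_le:
  fixes f :: "real \<Rightarrow> 'a::real_normed_vector"
  assumes "\<And>t. (f has_vector_derivative f' t) (at t)" and "\<And>t. norm (f' t) \<le> B"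
  shows "norm (backward_diff f t) \<le> B"
proof -
  have "onorm (\<lambda>h. h *\<^sub>R f' x) \<le> B" for x
    using assms(2)[of x] by (intro onorm_le) (simp add: mult.commute[of B] mult_left_mono)
  then show ?thesis
    using differentiable_bound[of UNIV f "\<lambda>x h. h *\<^sub>R f' x" B t "t - 1"] assms(1)
    by (simp add: backward_diff_def has_vector_derivative_def)
qed

lemma norm_funpow_backward_diff_le:
  assumes "deriv_seq D" and "\<And>t. norm (D k t) \<le> B"
  shows "norm ((backward_diff ^^ k) (D 0) t) \<le> B"
  using assms
proof (induction k arbitrary: D)
  case (Suc k)
  have "norm (backward_diff (D k) t) \<le> B" for t
    by (rule norm_backward_diff_le[OF deriv_seqD[OF Suc.prems(1)] Suc.prems(2)])
  from Suc.IH[OF deriv_seq_backward_diff[OF Suc.prems(1)] this]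
  show ?case by (simp add: funpow_swap1)
qed simp

definition trig_sum :: "(real \<Rightarrow> real) \<Rightarrow> int \<Rightarrow> int \<Rightarrow> real \<Rightarrow> complex" where
  "trig_sum f a b t = (\<Sum>j=a..b. f (of_int j) *\<^sub>R cis (t * of_int j))"

lemma one_minus_cis_mult_trig_sum:
  assumes "\<And>j. j \<notin> {a..b} \<Longrightarrow> f (of_int j) = 0"
  shows "(1 - cis t) * trig_sum f a b t = trig_sum (backward_diff f) a (b + 1) t"
proof -
  have "trig_sum (\<lambda>s. f (s - 1)) a (b + 1) t
      = (\<Sum>j=a - 1..b. f (of_int j) *\<^sub>R cis (t * of_int (j + 1)))"
    unfolding trig_sum_def by (rule sum.reindex_bij_witness[of _ "\<lambda>j. j + 1" "\<lambda>j. j - 1"]) auto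
  also have "\<dots> = (\<Sum>j=a..b. f (of_int j) *\<^sub>R cis (t * of_int (j + 1)))"
    using assms by (intro sum.mono_neutral_right) auto
  also have "\<dots> = cis t * trig_sum f a b t"
    by (simp add: trig_sum_def sum_distrib_left cis_mult distrib_left add.commute)
  finally have shifted: "trig_sum (\<lambda>s. f (s - 1)) a (b + 1) t = cis t * trig_sum f a b t" .
  have "trig_sum f a b t = trig_sum f a (b + 1) t"
    unfolding trig_sum_def using assms by (intro sum.mono_neutral_left) auto
  moreover have "trig_sum (backward_diff f) a (b + 1) t
      = trig_sum f a (b + 1) t - trig_sum (\<lambda>s. f (s - 1)) a (b + 1) t"
    by (simp add: trig_sum_def backward_diff_def scaleR_diff_left sum_subtractf)
  ultimately show ?thesis
    by (simp add: shifted left_diff_distrib)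
qed

lemma one_minus_cis_power_mult_trig_sum:
  assumes "\<And>j. j \<notin> {a..b} \<Longrightarrow> f (of_int j) = 0"
  shows "(1 - cis t) ^ k * trig_sum f a b t = trig_sum ((backward_diff ^^ k) f) a (b + int k) t"
  using assms
proof (induction k arbitrary: f b)
  case (Suc k)
  have "backward_diff f (of_int j) = 0" if "j \<notin> {a..b + 1}" for j
    using that Suc.prems[of j] Suc.prems[of "j - 1"] by (auto simp: backward_diff_def)
  note IH = Suc.IH[of "b + 1" "backward_diff f", OF this]
  have "(1 - cis t) ^ Suc k * trig_sum f a b t = (1 - cis t) ^ k * ((1 - cis t) * trig_sum f a b t)"
    by (simp only: power_Suc2 mult.assoc)
  also have "(1 - cis t) * trig_sum f a b t = trig_sum (backward_diff f) a (b + 1) t"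
    by (rule one_minus_cis_mult_trig_sum) (rule Suc.prems)
  also note IH
  finally show ?case
    by (simp add: funpow_swap1 add_ac)
qed simp

lemma norm_trig_sum_le:
  assumes D: "deriv_seq D" and D_le: "\<And>t. \<bar>D k t\<bar> \<le> B" and "a \<le> b"
    and supp: "\<And>j. j \<notin> {a..b} \<Longrightarrow> D 0 (of_int j) = 0"
  shows "norm (1 - cis t) ^ k * norm (trig_sum (D 0) a b t) \<le> of_int (b + int k - a + 1) * B"
proof -
  have "norm (1 - cis t) ^ k * norm (trig_sum (D 0) a b t)
      = norm (trig_sum ((backward_diff ^^ k) (D 0)) a (b + int k) t)"
    using one_minus_cis_power_mult_trig_sum[of a b "D 0" t k] supp
    by (simp flip: norm_mult norm_power)
  also have "\<dots> \<le> (\<Sum>j=a..b + int k. B)"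
    unfolding trig_sum_def using norm_funpow_backward_diff_le[OF D, of k B] D_le
    by (intro sum_norm_le) simp
  finally show ?thesis
    using \<open>a \<le> b\<close> by (simp add: add_ac)
qed

lemma sin_ge_two_div_pi_mult:
  assumes "0 \<le> x" "x \<le> pi / 2"
  shows "2 / pi * x \<le> sin x"
proof -
  have "concave_on {0..pi / 2} sin"
    by (rule f''_le0_imp_concave[where f' = cos and f'' = "\<lambda>x. - sin x"])
       (auto intro!: derivative_eq_intros sin_ge_zero)
  from concave_onD[OF this, of "2 / pi * x" 0 "pi / 2"] show ?thesis
    using assms by (simp add: field_simps)
qed

lemma norm_one_minus_cis_ge:
  assumes "0 \<le> r" "r \<le> \<bar>t\<bar>" "\<bar>t\<bar> \<le> 2 * pi - r"
  shows "r / 2 \<le> norm (1 - cis t)"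
proof -
  define s where "s = min (\<bar>t\<bar> / 2) (pi - \<bar>t\<bar> / 2)"
  have s: "r / 2 \<le> s" "s \<le> pi / 2"
    using assms by (auto simp: s_def min_def)
  have "r / 4 \<le> 2 / pi * s"
    using s assms(1) mult_right_mono[of pi 4 r] pi_less_4 by (simp add: field_simps)
  also have "\<dots> \<le> sin s"
    using s assms(1) by (intro sin_ge_two_div_pi_mult) auto
  also have "\<dots> \<le> \<bar>sin (t / 2)\<bar>"
    by (auto simp: s_def min_def abs_if)
  finally have "r / 2 \<le> 2 * \<bar>sin (t / 2)\<bar>" by simp
  also have "\<dots> = norm (1 - cis t)"
    using dist_exp_i_1[of t] by (simp add: cis_conv_exp norm_minus_commute)
  finally show ?thesis .
qed

definition cos_sum :: "(real \<Rightarrow> real) \<Rightarrow> nat \<Rightarrow> real \<Rightarrow> real" where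
  "cos_sum f n t = (\<Sum>j=-2 * int n..2 * int n. f (of_int j / real n) * cos (t * of_int j))"

lemma norm_trig_sum_dilation_le:
  assumes D: "deriv_seq D" and D_le: "\<And>t. \<bar>D k t\<bar> \<le> B"
    and supp: "\<And>t. 2 \<le> \<bar>t\<bar> \<Longrightarrow> D 0 t = 0" and n: "n \<ge> 1"
  shows "norm (1 - cis t) ^ k * norm (trig_sum (\<lambda>s. D 0 (s / real n)) (-2 * int n) (2 * int n) t)
    \<le> (1 / real n) ^ k * (real (4 * n + 1 + k) * B)"
proof -
  define E where "E k s = (1 / real n) ^ k *\<^sub>R D k (1 / real n * s + 0)" for k s
  have "deriv_seq E"
    unfolding E_def by (rule deriv_seq_affine[OF D])
  moreover have "\<bar>E k s\<bar> \<le> (1 / real n) ^ k * B" for s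
    using D_le by (simp add: E_def abs_mult mult_left_mono)
  moreover have "E 0 (of_int j) = 0" if "j \<notin> {-2 * int n..2 * int n}" for j
  proof -
    have "2 * real n \<le> \<bar>real_of_int j\<bar>"
      using that by auto
    then show ?thesis
      using n by (simp add: E_def supp field_simps)
  qed
  ultimately have "norm (1 - cis t) ^ k * norm (trig_sum (E 0) (-2 * int n) (2 * int n) t)
      \<le> of_int (2 * int n + int k - (-2 * int n) + 1) * ((1 / real n) ^ k * B)"
    by (intro norm_trig_sum_le) auto
  moreover have "E 0 = (\<lambda>s. D 0 (s / real n))"
    by (simp add: fun_eq_iff E_def)
  ultimately show ?thesis
    by (simp add: mult_ac add_ac)
qed

lemma power_mult_cos_sum_le:
  assumes D: "deriv_seq D" "\<And>t. \<bar>D k t\<bar> \<le> B" "\<And>t. 2 \<le> \<bar>t\<bar> \<Longrightarrow> D 0 t = 0"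
    and n: "n \<ge> 1" and r: "0 \<le> r" "r \<le> \<bar>t\<bar>" "\<bar>t\<bar> \<le> 2 * pi - r"
  shows "(real n * r / 2) ^ k * \<bar>cos_sum (D 0) n t\<bar> \<le> real (4 * n + 1 + k) * B"
proof -
  let ?S = "trig_sum (\<lambda>s. D 0 (s / real n)) (-2 * int n) (2 * int n) t"
  have "cos_sum (D 0) n t = Re ?S"
    by (simp add: cos_sum_def trig_sum_def)
  then have "\<bar>cos_sum (D 0) n t\<bar> \<le> norm ?S"
    using abs_Re_le_cmod by (simp only:)
  then have "(r / 2) ^ k * \<bar>cos_sum (D 0) n t\<bar> \<le> norm (1 - cis t) ^ k * norm ?S"
    using r(1) by (intro mult_mono power_mono norm_one_minus_cis_ge r) auto
  also have "\<dots> \<le> (1 / real n) ^ k * (real (4 * n + 1 + k) * B)"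
    by (rule norm_trig_sum_dilation_le[OF D n])
  finally have "real n ^ k * ((r / 2) ^ k * \<bar>cos_sum (D 0) n t\<bar>)
      \<le> real n ^ k * ((1 / real n) ^ k * (real (4 * n + 1 + k) * B))"
    by (rule mult_left_mono) simp
  then show ?thesis
    using n by (simp add: power_divide power_mult_distrib)
qed

lemma exp_decay_of_power_bounds:
  fixes X c q A :: real
  assumes q: "0 \<le> q" and A: "1 \<le> A" and c: "0 \<le> c"
    and bound: "\<And>k. real k \<le> q \<Longrightarrow> q ^ k * X \<le> (c + real k) * (A * real k) ^ k"
  shows "X \<le> (c + q) * exp (1 - q / (exp 1 * A))"
proof -
  define w where "w = q / (exp 1 * A)"
  define k where "k = nat \<lfloor>w\<rfloor>"
  have "1 \<le> exp 1 * A"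
    using mult_mono[of 1 "exp 1" 1 A] A by simp
  then have w: "0 \<le> w" "w \<le> q"
    using q mult_left_mono[of 1 "exp 1 * A" q] by (auto simp: w_def divide_le_eq)
  then have k: "real k \<le> w" "w - 1 \<le> real k" "real k \<le> q"
    unfolding k_def by linarith+
  have "A * real k \<le> q * exp (- 1)"
    using mult_left_mono[OF k(1), of A] A by (simp add: w_def exp_minus field_simps)
  then have "(A * real k) ^ k \<le> q ^ k * exp (- real k)"
    using power_mono[of "A * real k" "q * exp (- 1)" k] A exp_of_nat_mult[of k "- 1 :: real"]
    by (simp add: power_mult_distrib)
  then have "(c + real k) * (A * real k) ^ k \<le> (c + real k) * (q ^ k * exp (- real k))"
    using c by (intro mult_left_mono) auto
  with bound[OF k(3)] have "q ^ k * X \<le> q ^ k * ((c + real k) * exp (- real k))"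
    by (simp add: mult.left_commute)
  moreover have "0 < q ^ k"
    using k(3) by (cases "k = 0") auto
  ultimately have "X \<le> (c + real k) * exp (- real k)"
    by (simp only: mult_le_cancel_left_pos)
  also have "\<dots> \<le> (c + q) * exp (1 - w)"
    using k c by (intro mult_mono) auto
  finally show ?thesis by (simp add: w_def)
qed

lemma log_smooth_power_mult_cos_sum_le:
  assumes D: "log_smooth A \<epsilon> D" "even_cutoff (D 0)" and "0 \<le> A" "0 \<le> \<epsilon>"
    and n: "n \<ge> 1" and r: "0 \<le> r" "r \<le> \<bar>t\<bar>" "\<bar>t\<bar> \<le> 2 * pi - r" and k: "real k \<le> real n * r"
  shows "(real n * r) ^ k * \<bar>cos_sum (D 0) n t\<bar>
    \<le> (real (4 * n + 1) + real k) * (2 * A * log_power \<epsilon> (real n * r) * real k) ^ k"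
proof -
  let ?L = "log_power \<epsilon> (real n * r)"
  have "(real n * r / 2) ^ k * \<bar>cos_sum (D 0) n t\<bar>
      \<le> real (4 * n + 1 + k) * (A ^ k * log_weight \<epsilon> k)"
    using D unfolding log_smooth_def even_cutoff_def by (intro power_mult_cos_sum_le n r) auto
  also have "\<dots> \<le> real (4 * n + 1 + k) * (A ^ k * (real k * ?L) ^ k)"
    using assms(3,4) k by (intro mult_left_mono log_weight_le_power) auto
  finally have "2 ^ k * ((real n * r / 2) ^ k * \<bar>cos_sum (D 0) n t\<bar>)
      \<le> 2 ^ k * (real (4 * n + 1 + k) * (A ^ k * (real k * ?L) ^ k))"
    by (rule mult_left_mono) simp
  then show ?thesis
    by (simp add: power_divide power_mult_distrib mult_ac add_ac)
qed

lemma abs_cos_sum_le: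
  assumes \<epsilon>: "0 < \<epsilon>" "\<epsilon> \<le> A" and D: "log_smooth (A / \<epsilon>) \<epsilon> D" "even_cutoff (D 0)"
    and n: "n \<ge> 1" and r: "0 \<le> r" "r \<le> \<bar>t\<bar>" "\<bar>t\<bar> \<le> 2 * pi - r"
  shows "\<bar>cos_sum (D 0) n t\<bar> \<le> 9 * exp 1 * real n
    * exp (- (1 / (2 * exp 1 * A) * \<epsilon> * real n * r / log_power \<epsilon> (real n * r)))"
proof -
  define q where "q = real n * r"
  define L where "L = 2 * (A / \<epsilon>) * log_power \<epsilon> q"
  have "r \<le> 4"
    using r pi_less_4 by linarith
  then have q: "0 \<le> q" "q \<le> 4 * real n"
    using r n by (auto simp: q_def mult.commute intro: mult_mono)
  then have "1 \<le> L"
    using \<epsilon> mult_mono[of 1 "2 * (A / \<epsilon>)" 1 "log_power \<epsilon> q"] log_power_ge_1[of \<epsilon> q]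
    by (simp add: L_def)
  moreover have "q ^ k * \<bar>cos_sum (D 0) n t\<bar> \<le> (real (4 * n + 1) + real k) * (L * real k) ^ k"
    if "real k \<le> q" for k
    using \<epsilon> that unfolding q_def L_def by (intro log_smooth_power_mult_cos_sum_le D n r) auto
  ultimately have "\<bar>cos_sum (D 0) n t\<bar> \<le> (real (4 * n + 1) + q) * exp (1 - q / (exp 1 * L))"
    using q by (intro exp_decay_of_power_bounds) auto
  also have "\<dots> \<le> (9 * real n) * exp (1 - q / (exp 1 * L))"
    using q n by (intro mult_right_mono) auto
  also have "\<dots> = 9 * exp 1 * real n * exp (- (1 / (2 * exp 1 * A) * \<epsilon> * q / log_power \<epsilon> q))"
    using \<epsilon> by (simp add: L_def exp_diff exp_minus field_simps)
  finally show ?thesis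
    by (simp add: q_def mult.assoc)
qed

subsection \<open>Localization of the kernel\<close>

lemma cos_sum_even:
  assumes "\<And>t. f (- t) = f t"
  shows "cos_sum f n t = f 0 + 2 * (\<Sum>j=1..2 * n. f (real j / real n) * cos (t * real j))"
proof -
  define g where "g j = f (of_int j / real n) * cos (t * of_int j)" for j
  have "{-2 * int n..2 * int n} = {-2 * int n..-1} \<union> {0} \<union> {1..2 * int n}"
    by auto
  then have "sum g {-2 * int n..2 * int n} = sum g {-2 * int n..-1} + g 0 + sum g {1..2 * int n}"
    by (simp add: sum.union_disjoint)
  also have "sum g {-2 * int n..-1} = sum g {1..2 * int n}"
    using assms[of "of_int _ / real n"]
    by (intro sum.reindex_bij_witness[of _ uminus uminus]) (auto simp: g_def)
  also have "sum g {1..2 * int n} = (\<Sum>j=1..2 * n. g (int j))"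
    by (rule sum.reindex_bij_witness[of _ int nat]) auto
  finally show ?thesis
    by (simp add: cos_sum_def g_def)
qed

lemma cheb_mult_cheb:
  assumes "j \<ge> 1"
  shows "cheb j x * cheb j y
    = (cos ((arccos x - arccos y) * real j) + cos ((arccos x + arccos y) * real j)) / pi"
proof -
  have cheb: "cheb j z = sqrt (2 / pi) * cos (real j * arccos z)" for z
    using assms by (simp add: cheb_def)
  have "cheb j x * cheb j y
      = (sqrt (2 / pi) * sqrt (2 / pi)) * (cos (real j * arccos x) * cos (real j * arccos y))"
    by (simp only: cheb mult_ac)
  also have "sqrt (2 / pi) * sqrt (2 / pi) = 2 / pi"
    by simp
  finally show ?thesis
    by (simp add: cos_add cos_diff algebra_simps)
qed

lemma kernel_eq_cos_sums:
  assumes f: "even_cutoff f" and n: "n \<ge> 1"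
  shows "kernel f n x y
    = (cos_sum f n (arccos x - arccos y) + cos_sum f n (arccos x + arccos y)) / (2 * pi)"
proof -
  have "kernel f n x y = (\<Sum>j\<in>{..2 * n}. f (real j / real n) * cheb j x * cheb j y)"
    unfolding kernel_def
  proof (rule suminf_finite)
    fix j assume "j \<notin> {..2 * n}"
    then have "2 \<le> \<bar>real j / real n\<bar>" using n by (simp add: field_simps)
    then show "f (real j / real n) * cheb j x * cheb j y = 0"
      using f by (simp add: even_cutoff_def)
  qed simp
  also have "\<dots> = f 0 / pi + (\<Sum>j=1..2 * n. f (real j / real n) * (cheb j x * cheb j y))"
    by (simp add: atMost_atLeast0 sum.atLeast_Suc_atMost cheb_def mult.assoc)
  also have "\<dots> = f 0 / pi + (\<Sum>j=1..2 * n. f (real j / real n)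
      * (cos ((arccos x - arccos y) * real j) + cos ((arccos x + arccos y) * real j)) / pi)"
    by (simp add: cheb_mult_cheb)
  finally show ?thesis
    using f by (simp add: cos_sum_even even_cutoff_def distrib_left sum.distrib add_divide_distrib
        sum_divide_distrib[symmetric])
qed

lemma abs_kernel_le:
  assumes \<epsilon>: "0 < \<epsilon>" "\<epsilon> \<le> A" and D: "log_smooth (A / \<epsilon>) \<epsilon> D" "even_cutoff (D 0)"
    and n: "n \<ge> 1" and x: "x \<in> {-1..1}" and y: "y \<in> {-1..1}"
  shows "\<bar>kernel (D 0) n x y\<bar> \<le> 9 * exp 1 * real n
    * exp (- (1 / (2 * exp 1 * A) * \<epsilon> * real n * rho x y)
        / (ln (exp 1 + real n * rho x y)) powr (1 + \<epsilon>))" (is "_ \<le> ?R")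
proof -
  let ?a = "arccos x" and ?b = "arccos y"
  have ab: "0 \<le> ?a" "?a \<le> pi" "0 \<le> ?b" "?b \<le> pi"
    using arccos_bounded[of x] arccos_bounded[of y] x y by auto
  have "\<bar>cos_sum (D 0) n (?a - ?b)\<bar> \<le> ?R" "\<bar>cos_sum (D 0) n (?a + ?b)\<bar> \<le> ?R"
    using ab unfolding minus_divide_left[symmetric] log_power_def[symmetric]
    by (intro abs_cos_sum_le[OF \<epsilon> D n]; simp add: rho_def abs_if)+
  then have "\<bar>cos_sum (D 0) n (?a - ?b) + cos_sum (D 0) n (?a + ?b)\<bar> / (2 * pi) \<le> 2 * ?R / (2 * pi)"
    by (intro divide_right_mono) auto
  also have "\<dots> \<le> 2 * ?R / 2"
    using pi_gt3 by (intro divide_left_mono) auto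
  finally show ?thesis
    by (simp add: kernel_eq_cos_sums[OF D(2) n] mult_ac)
qed

theorem theorem2p1:
  shows "\<exists>c'>0. \<forall>\<epsilon>::real. 0 < \<epsilon> \<and> \<epsilon> \<le> 1 \<longrightarrow>
    (\<forall>adm \<in> {admissible_a, admissible_b, admissible_c}.
      \<exists>f c. adm f \<and> c > 0 \<and>
        (\<forall>n::nat. n \<ge> 1 \<longrightarrow> (\<forall>x\<in>{-1..1}. \<forall>y\<in>{-1..1}.
          \<bar>kernel f n x y\<bar> \<le> c * real n * exp (- (c' * \<epsilon> * real n * rho x y)
             / (ln (exp 1 + real n * rho x y)) powr (1 + \<epsilon>)))))"
proof (intro exI[of _ "1 / (2 * exp 1 * 160)"] conjI allI impI ballI)
  fix \<epsilon> :: real and adm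
  assume \<epsilon>: "0 < \<epsilon> \<and> \<epsilon> \<le> 1" and "adm \<in> {admissible_a, admissible_b, admissible_c}"
  then obtain D where "adm (D 0)" and D: "log_smooth (160 / \<epsilon>) \<epsilon> D" "even_cutoff (D 0)"
    using exists_log_smooth_cutoff by blast
  then show "\<exists>f c. adm f \<and> c > 0 \<and>
        (\<forall>n::nat. n \<ge> 1 \<longrightarrow> (\<forall>x\<in>{-1..1}. \<forall>y\<in>{-1..1}.
          \<bar>kernel f n x y\<bar> \<le> c * real n * exp (- (1 / (2 * exp 1 * 160) * \<epsilon> * real n * rho x y)
             / (ln (exp 1 + real n * rho x y)) powr (1 + \<epsilon>))))"
    using \<epsilon> by (intro exI[of _ "D 0"] exI[of _ "9 * exp 1"] conjI allI impI ballI
        abs_kernel_le[OF _ _ D]) auto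
qed simp

end
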